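(* Let $n\ge 1$ be an integer, let $I\subset[0,\infty)$ be an interval, and let $f:I\to\mathbb{R}$ be an $n$-times differentiable function on $I^\circ$ such that $f^{(n)}\in L^1[a,b]$, where $a,b\in I$, $a<b$. Let $p,q$ be conjugate numbers where $q\ge 1$ and $\frac1p=\frac{q-1}{q}$. If $|f^{(n)}|^q$ is $s$-convex (in the second sense) on $[a,b]$ for some fixed $s\in(0,1]$, then $$\left|\sum_{m=1}^n(-1)^{n-m+2}\frac{(b-a)^m}{m!}\left[f^{(m-1)}(b)-(-1)^m f^{(m-1)}(a)\right]+2(-1)^n\int_a^b f(x)\,dx\right|$$ $$\le\frac{(b-a)^{n+1}}{n!}\left(\frac{1}{n+1}\right)^{\frac{q-1}{q}}\Big[\left\{\beta(s+1,n+1)|f^{(n)}(a)|^q+\beta(1,n+s+1)|f^{(n)}(b)|^q\right\}^{\frac1q}$$ $$\qquad+\left\{\beta(s+1,n+1)|f^{(n)}(b)|^q+\beta(1,n+s+1)|f^{(n)}(a)|^q\right\}^{\frac1q}\Big].$$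
   Context: $I^\circ$ denotes the interior of $I$. A real function $g$ on $[a,b]\subset[0,\infty)$ is $s$-convex (in the second sense), $s\in(0,1]$, if $g(tx+(1-t)y)\le t^s g(x)+(1-t)^s g(y)$ for all $x,y\in[a,b]$ and $t\in[0,1]$. The Beta function is $\beta(x,y)=\int_0^1 t^{x-1}(1-t)^{y-1}\,dt$ for $x,y>0$. It is understood that $f$ is $n$ times differentiable at every point of $[a,b]$ (one-sided at a point that is an endpoint of $I$), so that $f^{(n)}$ is defined on all of $[a,b]$; $f^{(0)}=f$. *)

theory Defs
  imports "HOL-Analysis.Analysis"
begin

text \<open>
  The derivatives of a function \<open>f\<close> defined on an interval \<open>S\<close>, taken along \<open>S\<close>: two-sided at
  interior points of \<open>S\<close> and one-sided at an endpoint belonging to \<open>S\<close>.  Only the values of \<open>f\<close>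
  on \<open>S\<close> matter at points of a nondegenerate interval \<open>S\<close>, and the derivative is unique there.
\<close>

primrec iter_deriv :: "real set \<Rightarrow> (real \<Rightarrow> real) \<Rightarrow> nat \<Rightarrow> real \<Rightarrow> real" where
  "iter_deriv S f 0 = f"
| "iter_deriv S f (Suc k) = (\<lambda>x. vector_derivative (iter_deriv S f k) (at x within S))"

text \<open>
  The function is required to be differentiable only at the points of \<open>D\<close>.  In the intended use
  \<open>D\<close> is \<open>S\<close> with at most some endpoints removed.  Then \<open>D\<close> is open relative to \<open>S\<close>, so that the
  unspecified values of \<open>iter_deriv S f k\<close> outside \<open>D\<close> do not influence derivatives at points
  of \<open>D\<close>.
\<close>

definition times_differentiable_on ::
    "nat \<Rightarrow> real set \<Rightarrow> (real \<Rightarrow> real) \<Rightarrow> real set \<Rightarrow> bool" where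
  "times_differentiable_on n S f D \<longleftrightarrow>
     (\<forall>k<n. \<forall>x\<in>D. iter_deriv S f k differentiable (at x within S))"

definition s_convex_on :: "real \<Rightarrow> real \<Rightarrow> real \<Rightarrow> (real \<Rightarrow> real) \<Rightarrow> bool" where
  "s_convex_on s a b g \<longleftrightarrow>
     0 \<le> a \<and> 0 < s \<and> s \<le> 1 \<and>
     (\<forall>x\<in>{a..b}. \<forall>y\<in>{a..b}. \<forall>t\<in>{0..1}.
        g (t * x + (1 - t) * y) \<le> t powr s * g x + (1 - t) powr s * g y)"

text \<open>
  The library defines \<open>Beta\<close> through the Gamma function; for positive real arguments it is
  Euler's integral.
\<close>

lemma Beta_eq_integral:
  fixes x y :: real
  assumes "x > 0" "y > 0"
  shows "Beta x y = integral {0..1} (\<lambda>t. t powr (x - 1) * (1 - t) powr (y - 1))"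
  using has_integral_Beta_real[OF assms] by (simp add: integral_unique)

end

theory Submission
  imports Defs
begin

text \<open>
  Put \<open>F = f\<^sup>(\<^sup>n\<^sup>)\<close> and \<open>J c = \<integral>\<^sub>a\<^sup>b (x - c)\<^sup>n / n! * F x dx\<close>.  Integrating \<open>n\<close> times by parts turns \<open>J c\<close> into
  boundary terms plus \<open>(-1)\<^sup>n \<integral>\<^sub>a\<^sup>b f\<close>.  For \<open>c = a\<close> only the boundary terms at \<open>b\<close> survive, for \<open>c = b\<close>
  only those at \<open>a\<close>, and the quantity to be estimated is exactly \<open>J a + J b\<close>
  (\<open>has_integral_iterated_by_parts\<close>).

  The two summands are bounded in the same way.  Let \<open>d\<close> be the endpoint opposite to \<open>c\<close>.  The
  substitution \<open>x = (1 - t) c + t d\<close> maps \<open>[0,1]\<close> onto \<open>[a,b]\<close> with the zero of the weight at \<open>t = 0\<close>,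
  whence \<open>\<bar>J c\<bar> = (b - a)\<^sup>n\<^sup>+\<^sup>1 / n! * \<bar>\<integral>\<^sub>0\<^sup>1 t\<^sup>n \<phi> t dt\<bar>\<close> with \<open>\<phi> t = F ((1 - t) c + t d)\<close>.  By \<open>s\<close>-convexity
  \<open>\<bar>\<phi> t\<bar>\<^sup>q \<le> h t\<close>, where \<open>h t = t\<^sup>s \<bar>F d\<bar>\<^sup>q + (1 - t)\<^sup>s \<bar>F c\<bar>\<^sup>q\<close>, and the power mean inequality for the weight
  \<open>t\<^sup>n\<close> (\<open>integral_mult_powr_le\<close>) gives
  \<open>\<integral> t\<^sup>n h\<^sup>1\<^sup>/\<^sup>q \<le> (\<integral> t\<^sup>n)\<^sup>1\<^sup>-\<^sup>1\<^sup>/\<^sup>q (\<integral> t\<^sup>n h)\<^sup>1\<^sup>/\<^sup>q\<close>.  The first integral on the right is \<open>1/(n+1)\<close> and the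
  second is a combination of two Beta integrals (\<open>abs_integral_power_mult_le\<close>).

  Replacing \<open>\<bar>\<phi>\<bar>\<^sup>q\<close> by the explicit bound \<open>h\<close> before applying the power mean inequality means that
  this inequality is needed only for continuous functions.
\<close>

text \<open>
  This is Hoelder's inequality for \<open>w\<^sup>1\<^sup>-\<^sup>r\<close> and \<open>(w h)\<^sup>r\<close>.  Integrated against \<open>w\<close>, Young's inequality
  \<open>h\<^sup>r c\<^sup>1\<^sup>-\<^sup>r \<le> r h + (1 - r) c\<close> yields it when the constant \<open>c\<close> is the weighted mean of \<open>h\<close>.
\<close>

lemma integral_mult_powr_le:
  fixes w h :: "real \<Rightarrow> real"
  assumes w: "continuous_on {a..b} w" "\<And>x. x \<in> {a..b} \<Longrightarrow> 0 \<le> w x"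
    and h: "continuous_on {a..b} h" "\<And>x. x \<in> {a..b} \<Longrightarrow> 0 \<le> h x"
    and r: "0 < r" "r \<le> 1"
  shows "integral {a..b} (\<lambda>x. w x * h x powr r)
       \<le> integral {a..b} w powr (1 - r) * integral {a..b} (\<lambda>x. w x * h x) powr r"
proof -
  define W where "W = integral {a..b} w"
  define V where "V = integral {a..b} (\<lambda>x. w x * h x)"
  have contV: "continuous_on {a..b} (\<lambda>x. w x * h x)"
    by (intro continuous_intros w h)
  have W0: "0 \<le> W" and V0: "0 \<le> V"
    unfolding W_def V_def using w h contV
    by (auto intro!: integral_nonneg integrable_continuous_real)
  show ?thesis
    \<comment> \<open>Young's inequality requires a positive mean \<open>V / W\<close>; otherwise \<open>w h\<close> vanishes by continuity.\<close>
  proof (cases "W = 0 \<or> V = 0")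
    case True
    have "integral {a..b} (\<lambda>x. w x * h x powr r) = 0"
    proof (cases "a < b")
      case ab: True
      have "w x * h x = 0" if "x \<in> {a..b}" for x
        using True integral_eq_0_iff[OF w(1) ab w(2)] integral_eq_0_iff[OF contV ab] w(2) h(2) that
        unfolding W_def V_def by auto
      then have "w x * h x powr r = 0" if "x \<in> {a..b}" for x
        using that r by fastforce
      then show ?thesis
        using integral_cong[of "{a..b}" "\<lambda>x. w x * h x powr r" "\<lambda>x. 0"] by simp
    next
      case False
      then show ?thesis by (cases "a = b") auto
    qed
    then show ?thesis by simp
  next
    case False
    with W0 V0 have W: "0 < W" and V: "0 < V" by auto
    define c where "c = V / W"
    have c: "0 < c" using W V by (simp add: c_def)
    have young: "h x powr r * c powr (1 - r) \<le> r * h x + (1 - r) * c" if x: "x \<in> {a..b}" for x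
    proof (cases "h x = 0")
      case True
      then show ?thesis using r c by simp
    next
      case False
      then show ?thesis
        using Youngs_inequality_0[of r "1 - r" "h x" c] h(2)[OF x] r c by simp
    qed
    have "integral {a..b} (\<lambda>x. w x * h x powr r) * c powr (1 - r)
        = integral {a..b} (\<lambda>x. w x * h x powr r * c powr (1 - r))"
      by simp
    also have "\<dots> \<le> integral {a..b} (\<lambda>x. r * (w x * h x) + (1 - r) * c * w x)"
    proof (rule integral_le)
      show "(\<lambda>x. w x * h x powr r * c powr (1 - r)) integrable_on {a..b}"
        using r h by (intro integrable_continuous_real continuous_intros w continuous_on_powr') auto
      show "(\<lambda>x. r * (w x * h x) + (1 - r) * c * w x) integrable_on {a..b}"
        by (intro integrable_continuous_real continuous_intros w h)
      show "w x * h x powr r * c powr (1 - r) \<le> r * (w x * h x) + (1 - r) * c * w x"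
        if "x \<in> {a..b}" for x
        using mult_left_mono[OF young[OF that] w(2)[OF that]] by (simp add: algebra_simps)
    qed
    also have "\<dots> = r * V + (1 - r) * c * W"
      unfolding V_def W_def
      using integrable_continuous_real[OF contV] integrable_continuous_real[OF w(1)]
      by (subst integral_add) (auto intro: integrable_on_mult_right)
    also have "\<dots> = V" using W by (simp add: c_def field_simps)
    also have "V = V powr r * W powr (1 - r) * c powr (1 - r)"
      using W V by (simp add: c_def powr_divide flip: powr_add)
    finally show ?thesis using c by (simp add: W_def V_def mult.commute)
  qed
qed

text \<open>
  In the step, \<open>(P D\<^sub>n)' = P D\<^sub>n\<^sub>+\<^sub>1 + P' D\<^sub>n\<close> with \<open>P x = (x - c)\<^sup>n\<^sup>+\<^sup>1 / (n+1)!\<close>, and \<open>P' D\<^sub>n\<close> is covered by the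
  induction hypothesis.  The product with the highest derivative thus gets its integral as a
  difference of two integrals that exist.
\<close>

lemma has_integral_iterated_by_parts:
  fixes D :: "nat \<Rightarrow> real \<Rightarrow> real"
  assumes "a \<le> b"
    and "\<And>k x. k < n \<Longrightarrow> x \<in> {a..b} \<Longrightarrow>
           (D k has_vector_derivative D (Suc k) x) (at x within {a..b})"
    and "D 0 integrable_on {a..b}"
  shows "((\<lambda>x. (x - c) ^ n / fact n * D n x) has_integral
           (\<Sum>m=1..n. (-1) ^ (n - m) *
              ((b - c) ^ m / fact m * D (m - 1) b - (a - c) ^ m / fact m * D (m - 1) a))
           + (-1) ^ n * integral {a..b} (D 0)) {a..b}"
  using assms(2)
proof (induction n)
  case 0
  then show ?case using assms(3) by (simp add: has_integral_integral)
next
  case (Suc n)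
  define P where "P = (\<lambda>m x. (x - c) ^ m / fact m :: real)"
  have P: "(P (Suc n) has_vector_derivative P n x) (at x within {a..b})" for x
    unfolding P_def has_real_derivative_iff_has_vector_derivative[symmetric]
    by (auto intro!: derivative_eq_intros simp: field_simps simp del: of_nat_Suc power_Suc)
  have "((\<lambda>x. P (Suc n) x * D (Suc n) x + P n x * D n x) has_integral
      P (Suc n) b * D n b - P (Suc n) a * D n a) {a..b}"
    using assms(1) P Suc.prems[of n]
    by (intro fundamental_theorem_of_calculus has_vector_derivative_mult) auto
  from has_integral_diff[OF this Suc.IH[folded P_def, OF Suc.prems]]
  have main: "((\<lambda>x. P (Suc n) x * D (Suc n) x) has_integral
      (P (Suc n) b * D n b - P (Suc n) a * D n a)
      - ((\<Sum>m=1..n. (-1) ^ (n - m) * (P m b * D (m - 1) b - P m a * D (m - 1) a))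
         + (-1) ^ n * integral {a..b} (D 0))) {a..b}"
    by (simp add: P_def)
  have "(\<Sum>m=1..n. (-1) ^ (Suc n - m) * (P m b * D (m - 1) b - P m a * D (m - 1) a))
      = - (\<Sum>m=1..n. (-1) ^ (n - m) * (P m b * D (m - 1) b - P m a * D (m - 1) a))"
    unfolding sum_negf[symmetric] by (intro sum.cong) (auto simp: Suc_diff_le)
  then show ?case
    using main unfolding P_def[symmetric] by (simp add: P_def algebra_simps)
qed

text \<open>
  The estimate for one summand after rescaling to the unit interval.  The value \<open>A\<close> belongs to the end
  \<open>t = 0\<close>, the centre of the weight \<open>t\<^sup>n\<close>, so it is paired with \<open>\<integral> t\<^sup>n (1 - t)\<^sup>s\<close> and \<open>B\<close> with \<open>\<integral> t\<^sup>n\<^sup>+\<^sup>s\<close>.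
\<close>

lemma abs_integral_power_mult_le:
  fixes \<phi> :: "real \<Rightarrow> real"
  assumes q: "1 \<le> q" and s: "0 < s" and AB: "0 \<le> A" "0 \<le> B"
    and int: "(\<lambda>t. t ^ n * \<phi> t) integrable_on {0..1}"
    and bound: "\<And>t. t \<in> {0..1} \<Longrightarrow> \<bar>\<phi> t\<bar> powr q \<le> t powr s * B + (1 - t) powr s * A"
  shows "\<bar>integral {0..1} (\<lambda>t. t ^ n * \<phi> t)\<bar>
       \<le> (1 / (real n + 1)) powr ((q - 1) / q) *
         (Beta (s + 1) (real n + 1) * A + Beta 1 (real n + s + 1) * B) powr (1 / q)"
proof -
  define h where "h = (\<lambda>t. t powr s * B + (1 - t) powr s * A)"
  have h0: "0 \<le> h t" for t using AB by (simp add: h_def)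
  have conth: "continuous_on {0..1} h"
    unfolding h_def using s by (intro continuous_intros continuous_on_powr') auto
  have pt: "\<bar>\<phi> t\<bar> \<le> h t powr (1 / q)" if "t \<in> {0..1}" for t
  proof -
    have "\<bar>\<phi> t\<bar> = (\<bar>\<phi> t\<bar> powr q) powr (1 / q)" using q by (simp add: powr_powr)
    also have "\<dots> \<le> h t powr (1 / q)"
      using bound[OF that] q by (intro powr_mono2) (auto simp: h_def)
    finally show ?thesis .
  qed
  have "\<bar>integral {0..1} (\<lambda>t. t ^ n * \<phi> t)\<bar> \<le> integral {0..1} (\<lambda>t. t ^ n * h t powr (1 / q))"
    unfolding real_norm_def[symmetric]
  proof (rule integral_norm_bound_integral[OF int])
    show "(\<lambda>t. t ^ n * h t powr (1 / q)) integrable_on {0..1}"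
      using q h0 by (intro integrable_continuous_real continuous_intros continuous_on_powr' conth) auto
    show "norm (t ^ n * \<phi> t) \<le> t ^ n * h t powr (1 / q)" if "t \<in> {0..1}" for t
      using pt[OF that] that by (auto simp: abs_mult intro!: mult_left_mono)
  qed
  also have "\<dots> \<le> integral {0..1} (\<lambda>t::real. t ^ n) powr (1 - 1 / q)
                 * integral {0..1} (\<lambda>t. t ^ n * h t) powr (1 / q)"
    using q h0 by (intro integral_mult_powr_le conth continuous_intros) auto
  also have "integral {0..1} (\<lambda>t::real. t ^ n) = 1 / (real n + 1)"
  proof (rule integral_unique)
    have "((\<lambda>t::real. t ^ n) has_integral 1 ^ Suc n / real (Suc n) - 0 ^ Suc n / real (Suc n)) {0..1}"
      by (rule fundamental_theorem_of_calculus)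
        (auto intro!: derivative_eq_intros simp del: power_Suc of_nat_Suc
          simp flip: has_real_derivative_iff_has_vector_derivative)
    then show "((\<lambda>t::real. t ^ n) has_integral 1 / (real n + 1)) {0..1}"
      by (simp add: add.commute)
  qed
  also have "integral {0..1} (\<lambda>t. t ^ n * h t)
      = Beta (s + 1) (real n + 1) * A + Beta 1 (real n + s + 1) * B"
  proof -
    have A: "((\<lambda>t. t powr real n * (1 - t) powr s) has_integral Beta (real n + 1) (s + 1)) {0..1}"
      using has_integral_Beta_real[of "real n + 1" "s + 1"] s by simp
    have B: "((\<lambda>t. t powr (real n + s) * (1 - t) powr 0) has_integral Beta (real n + s + 1) 1) {0..1}"
      using has_integral_Beta_real[of "real n + s + 1" 1] s by simp
    have "((\<lambda>t. t ^ n * h t) has_integral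
        Beta (real n + 1) (s + 1) * A + Beta (real n + s + 1) 1 * B) {0..1}"
    proof (rule has_integral_spike_finite[OF _ _ has_integral_add[OF
          has_integral_mult_left[OF A, of A] has_integral_mult_left[OF B, of B]]])
      \<comment> \<open>As \<open>0 powr 0 = 0\<close>, the factor \<open>(1 - t) powr 0\<close> is \<open>0\<close> at \<open>t = 1\<close>, as is \<open>t powr n\<close> at \<open>t = n = 0\<close>.\<close>
      show "finite {0, 1 :: real}" by simp
      show "t ^ n * h t = t powr real n * (1 - t) powr s * A + t powr (real n + s) * (1 - t) powr 0 * B"
        if "t \<in> {0..1} - {0, 1}" for t
        using that by (simp add: h_def powr_add powr_realpow algebra_simps)
    qed
    then show ?thesis by (simp add: integral_unique Beta_commute)
  qed
  also have "1 - 1 / q = (q - 1) / q" using q by (simp add: field_simps)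
  finally show ?thesis .
qed

text \<open>
  Both orientations are admitted, so that the zero of either weight \<open>(x - a)\<^sup>n\<close> or \<open>(x - b)\<^sup>n\<close> can be
  moved to \<open>t = 0\<close>.
\<close>

lemma has_integral_to_unit:
  fixes g :: "real \<Rightarrow> real"
  assumes "a < b" and "(c = a \<and> d = b) \<or> (c = b \<and> d = a)"
    and "(g has_integral i) {a..b}"
  shows "((\<lambda>t. g ((1 - t) * c + t * d)) has_integral i / (b - a)) {0..1}"
proof -
  have dc: "d - c \<noteq> 0" "\<bar>d - c\<bar> = b - a" using assms by auto
  have "(\<lambda>x. x / (d - c) - c / (d - c)) ` {a..b} = {0..1}"
    unfolding image_affinity_atLeastAtMost_div_diff
    using assms(1,2) by (auto simp: diff_divide_distrib[symmetric])
  with has_integral_affinity[of g i a b "d - c" c] assms(3) dc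
  show ?thesis by (simp add: algebra_simps divide_simps)
qed

theorem theorem6:
  fixes n :: nat and I :: "real set" and f :: "real \<Rightarrow> real"
    and a b q s :: real and p :: ennreal
  assumes "n \<ge> 1"
    and "is_interval I" and "I \<subseteq> {0..}"
    and "a \<in> I" and "b \<in> I" and "a < b"
    and "times_differentiable_on n I f (interior I \<union> {a..b})"
    and "iter_deriv I f n absolutely_integrable_on {a..b}"
    and "q \<ge> 1" and "1 / p = ennreal ((q - 1) / q)"
    and "0 < s" and "s \<le> 1"
    and "s_convex_on s a b (\<lambda>x. \<bar>iter_deriv I f n x\<bar> powr q)"
  shows
    "\<bar>(\<Sum>m=1..n. (-1) ^ (n - m + 2) * ((b - a) ^ m / fact m) *
          (iter_deriv I f (m - 1) b - (-1) ^ m * iter_deriv I f (m - 1) a))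
        + 2 * (-1) ^ n * integral {a..b} f\<bar>
     \<le> (b - a) ^ (n + 1) / fact n * (1 / (real n + 1)) powr ((q - 1) / q) *
       ((Beta (s + 1) (real n + 1) * \<bar>iter_deriv I f n a\<bar> powr q
           + Beta 1 (real n + s + 1) * \<bar>iter_deriv I f n b\<bar> powr q) powr (1 / q)
        + (Beta (s + 1) (real n + 1) * \<bar>iter_deriv I f n b\<bar> powr q
           + Beta 1 (real n + s + 1) * \<bar>iter_deriv I f n a\<bar> powr q) powr (1 / q))"
proof -
  define D where "D = iter_deriv I f"
  have sub: "{a..b} \<subseteq> I"
    using assms(2,4,5) by (meson atLeastAtMost_iff is_interval_1 subsetI)
  have deriv: "(D k has_vector_derivative D (Suc k) x) (at x within {a..b})"
    if "k < n" "x \<in> {a..b}" for k x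
    using assms(7) that sub unfolding times_differentiable_on_def D_def
    by (auto intro!: has_vector_derivative_within_subset[OF _ sub] simp: vector_derivative_works)
  have D0: "D 0 integrable_on {a..b}"
    using deriv[of 0] assms(1)
    by (intro integrable_continuous_real continuous_on_vector_derivative[of _ _ "D 1"]) auto
  define J where "J = (\<lambda>c. (\<Sum>m=1..n. (-1) ^ (n - m) *
      ((b - c) ^ m / fact m * D (m - 1) b - (a - c) ^ m / fact m * D (m - 1) a))
      + (-1) ^ n * integral {a..b} (D 0))"
  have J: "((\<lambda>x. (x - c) ^ n / fact n * D n x) has_integral J c) {a..b}" for c
    unfolding J_def using assms(6) deriv D0 by (intro has_integral_iterated_by_parts) auto
  have identity: "(\<Sum>m=1..n. (-1) ^ (n - m + 2) * ((b - a) ^ m / fact m) *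
          (D (m - 1) b - (-1) ^ m * D (m - 1) a))
        + 2 * (-1) ^ n * integral {a..b} (D 0) = J a + J b"
  proof -
    have flip: "(a - b) ^ m = (-1) ^ m * (b - a) ^ m" for m
      by (simp flip: power_mult_distrib)
    show ?thesis
      unfolding J_def flip
      by (auto simp: sum.distrib[symmetric] power_0_left algebra_simps intro!: sum.cong)
  qed
  have bound: "\<bar>J c\<bar> \<le> (b - a) ^ (n + 1) / fact n * ((1 / (real n + 1)) powr ((q - 1) / q) *
         (Beta (s + 1) (real n + 1) * \<bar>D n c\<bar> powr q + Beta 1 (real n + s + 1) * \<bar>D n d\<bar> powr q) powr (1 / q))"
    (is "_ \<le> _ * ?R")
    if cd: "(c = a \<and> d = b) \<or> (c = b \<and> d = a)" for c d
  proof -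
    define \<phi> where "\<phi> = (\<lambda>t. D n ((1 - t) * c + t * d))"
    have dc: "d - c \<noteq> 0" "\<bar>d - c\<bar> = b - a" using cd assms(6) by auto
    have "((\<lambda>t. ((1 - t) * c + t * d - c) ^ n / fact n * \<phi> t) has_integral J c / (b - a)) {0..1}"
      unfolding \<phi>_def by (rule has_integral_to_unit[OF assms(6) cd J])
    also have "(\<lambda>t. ((1 - t) * c + t * d - c) ^ n / fact n * \<phi> t)
        = (\<lambda>t. (d - c) ^ n / fact n * (t ^ n * \<phi> t))"
      by (auto simp: fun_eq_iff algebra_simps simp flip: power_mult_distrib)
    finally have "((\<lambda>t. fact n / (d - c) ^ n * ((d - c) ^ n / fact n * (t ^ n * \<phi> t))) has_integral
        fact n / (d - c) ^ n * (J c / (b - a))) {0..1}"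
      by (rule has_integral_mult_right)
    then have *: "((\<lambda>t. t ^ n * \<phi> t) has_integral fact n / (d - c) ^ n * (J c / (b - a))) {0..1}"
      using dc by simp
    have "\<bar>integral {0..1} (\<lambda>t. t ^ n * \<phi> t)\<bar> \<le> ?R"
    proof (rule abs_integral_power_mult_le)
      show "\<bar>\<phi> t\<bar> powr q \<le> t powr s * \<bar>D n d\<bar> powr q + (1 - t) powr s * \<bar>D n c\<bar> powr q"
        if "t \<in> {0..1}" for t
        using assms(13) that cd assms(6) unfolding s_convex_on_def \<phi>_def D_def
        by (auto simp: add.commute)
    qed (use * assms in auto)
    also have "integral {0..1} (\<lambda>t. t ^ n * \<phi> t) = fact n / (d - c) ^ n * (J c / (b - a))"
      using * by (rule integral_unique)
    finally have "fact n / (b - a) ^ n * (\<bar>J c\<bar> / (b - a)) \<le> ?R"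
      using assms(6) dc by (simp add: abs_mult power_abs)
    then show ?thesis using assms(6) by (simp add: field_simps)
  qed
  have "\<bar>J a + J b\<bar> \<le> \<bar>J a\<bar> + \<bar>J b\<bar>" by (rule abs_triangle_ineq)
  also note add_mono[OF bound[of a b] bound[of b a]]
  finally show ?thesis
    using identity by (simp add: D_def algebra_simps)
qed

end
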